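(* Let $k\ge2$ and let $0<\alpha_1<\cdots<\alpha_k$ be integers with $\gcd(\alpha_1,\dots,\alpha_k)=1$. Assume that $\alpha_i\not\equiv\alpha_j\bmod\alpha_1$ for all $i\ne j$. Then $$F(\alpha_1,\dots,\alpha_k)\le 2\alpha_k\left\lfloor\frac{\alpha_1}{k}\right\rfloor-\alpha_1.$$
   Context: $F(\alpha_1,\dots,\alpha_k)$ denotes the Frobenius number: the greatest integer not belonging to the numerical semigroup $\{\sum_{i=1}^k x_i\alpha_i\mid x_i\in\mathbb Z_{\ge0}\}$. *)

theory Defs
  imports "HOL-Number_Theory.Cong"
begin

definition numerical_semigroup :: "nat \<Rightarrow> (nat \<Rightarrow> int) \<Rightarrow> int set" where
  "numerical_semigroup k \<alpha> = {(\<Sum>i=1..k. int (x i) * \<alpha> i) | x :: nat \<Rightarrow> nat. True}"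

text \<open>
  The greatest element is taken over all integers, so that the Frobenius number is \<open>-1\<close>
  if the semigroup contains every nonnegative integer. The value is meaningful only if a greatest
  missing integer exists, in particular for positive generators with greatest common divisor 1.
\<close>

definition frobenius_number :: "nat \<Rightarrow> (nat \<Rightarrow> int) \<Rightarrow> int" where
  "frobenius_number k \<alpha> = (GREATEST n. n \<notin> numerical_semigroup k \<alpha>)"

end

theory Submission
  imports Defs "HOL-Algebra.Elementary_Groups"
begin

text \<open>
  Let \<open>A\<close> be the set of residues of the generators modulo \<open>m = \<alpha> 1\<close>; it has \<open>k\<close> elements, contains
  \<open>0\<close> and generates the cyclic group of order \<open>m\<close>. For such a set, \<open>X + A\<close> is either the whole group
  or has at least \<open>card X + k / 2\<close> elements (Olson). This is proved by Hamidoune's method: by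
  submodularity, a smallest minimiser of \<open>card (X + A) - card X\<close> is a coset of a subgroup, and for a
  subgroup the estimate is clear. Hence, with \<open>q = m div k\<close>, the \<open>(2 * q - 1)\<close>-fold sumset of \<open>A\<close>
  has at least \<open>q * k\<close> elements or is everything, and by the pigeonhole principle the \<open>2 * q\<close>-fold
  sumset is the whole group. So every residue class contains a sum of \<open>2 * q\<close> generators, which
  is at most \<open>2 * q * \<alpha> k\<close>, and adding multiples of \<open>m\<close> reaches everything that exceeds
  \<open>2 * q * \<alpha> k - m\<close> in that class.
\<close>

section \<open>Product sets in finite abelian groups\<close>

lemma mem_set_mult_iff: "z \<in> H <#>\<^bsub>G\<^esub> K \<longleftrightarrow> (\<exists>h\<in>H. \<exists>k\<in>K. z = h \<otimes>\<^bsub>G\<^esub> k)"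
  by (auto simp: set_mult_def)

lemma set_mult_Un_left: "(X \<union> Y) <#>\<^bsub>G\<^esub> A = (X <#>\<^bsub>G\<^esub> A) \<union> (Y <#>\<^bsub>G\<^esub> A)"
  by (auto simp: set_mult_def)

lemma set_mult_Int_left_subset: "(X \<inter> Y) <#>\<^bsub>G\<^esub> A \<subseteq> (X <#>\<^bsub>G\<^esub> A) \<inter> (Y <#>\<^bsub>G\<^esub> A)"
  by (auto simp: set_mult_def)

lemma finite_set_mult: "finite X \<Longrightarrow> finite A \<Longrightarrow> finite (X <#>\<^bsub>G\<^esub> A)"
  by (auto simp: set_mult_def)

text \<open>Multiplication by \<open>A\<close> commutes with unions exactly, but with intersections
  only up to inclusion. As \<open>card\<close> itself is modular, the excess
  \<open>card (X <#> A) - card X\<close> is therefore submodular in \<open>X\<close>.\<close>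

lemma card_set_mult_submodular:
  assumes "finite X" "finite Y" "finite A"
  shows "card ((X \<inter> Y) <#>\<^bsub>G\<^esub> A) + card ((X \<union> Y) <#>\<^bsub>G\<^esub> A) \<le> card (X <#>\<^bsub>G\<^esub> A) + card (Y <#>\<^bsub>G\<^esub> A)"
proof -
  have fin: "finite (X <#>\<^bsub>G\<^esub> A)" "finite (Y <#>\<^bsub>G\<^esub> A)"
    using assms by (simp_all add: finite_set_mult)
  then have "card ((X \<inter> Y) <#>\<^bsub>G\<^esub> A) \<le> card ((X <#>\<^bsub>G\<^esub> A) \<inter> (Y <#>\<^bsub>G\<^esub> A))"
    by (intro card_mono set_mult_Int_left_subset) auto
  then show ?thesis
    using card_Un_Int[OF fin] by (simp add: set_mult_Un_left)
qed

lemma (in group) subset_set_mult: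
  assumes "X \<subseteq> carrier G" "\<one> \<in> A"
  shows "X \<subseteq> X <#> A"
proof
  fix x assume "x \<in> X"
  moreover from this have "x = x \<otimes> \<one>"
    using assms by auto
  ultimately show "x \<in> X <#> A"
    using assms(2) unfolding mem_set_mult_iff by blast
qed

lemma (in group) card_r_coset:
  assumes "X \<subseteq> carrier G" "g \<in> carrier G"
  shows "card (X #> g) = card X"
proof -
  have "X #> g = (\<lambda>x. x \<otimes> g) ` X"
    by (auto simp: r_coset_def)
  moreover have "inj_on (\<lambda>x. x \<otimes> g) X"
    using assms by (meson inj_onI right_cancel subsetD)
  ultimately show ?thesis
    by (simp add: card_image)
qed

lemma (in comm_group) r_coset_set_mult:
  assumes "X \<subseteq> carrier G" "A \<subseteq> carrier G" "g \<in> carrier G"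
  shows "(X #> g) <#> A = (X <#> A) #> g"
proof -
  have "l_coset G g A = A #> g"
    using assms by (auto simp: l_coset_def r_coset_def m_comm subset_iff)
  then show ?thesis
    using assms setmult_rcos_assoc[of X A g] rcos_assoc_lcos[of X A g] by simp
qed

text \<open>Pigeonhole: \<open>X\<close> and the set of all \<open>g \<otimes> inv a\<close> with
  \<open>a \<in> A\<close> are together too large to be disjoint, and a common element writes
  \<open>g\<close> as a product.\<close>

lemma (in group) set_mult_eq_carrier_of_card:
  assumes "finite (carrier G)" "X \<subseteq> carrier G" "A \<subseteq> carrier G"
    and "card (carrier G) < card X + card A"
  shows "X <#> A = carrier G"
proof
  show "X <#> A \<subseteq> carrier G"
    using assms by (rule_tac set_mult_closed)
  show "carrier G \<subseteq> X <#> A"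
  proof
    fix g assume g: "g \<in> carrier G"
    let ?B = "(\<lambda>a. g \<otimes> inv a) ` A"
    have "inj_on (\<lambda>a. g \<otimes> inv a) A"
    proof (rule inj_onI)
      fix x y assume "x \<in> A" "y \<in> A" "g \<otimes> inv x = g \<otimes> inv y"
      moreover from this have "x \<in> carrier G" "y \<in> carrier G"
        using assms(3) by auto
      ultimately show "x = y"
        using g inj_onD[OF inv_inj, of x y] by simp
    qed
    then have "card ?B = card A"
      by (rule card_image)
    moreover have "?B \<subseteq> carrier G"
      using assms g by auto
    ultimately have "X \<inter> ?B \<noteq> {}"
      using assms card_Un_disjoint[of X ?B] card_mono[of "carrier G" "X \<union> ?B"]
      by (metis Un_subset_iff finite_subset not_le)
    then obtain a where a: "a \<in> A" "g \<otimes> inv a \<in> X"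
      by auto
    then have "g = (g \<otimes> inv a) \<otimes> a"
      using assms g by (simp add: m_assoc subset_iff)
    with a show "g \<in> X <#> A"
      unfolding mem_set_mult_iff by blast
  qed
qed

text \<open>Hamidoune's duality: \<open>inv y \<otimes> a = inv f\<close> would put
  \<open>y = f \<otimes> a\<close> into \<open>F <#> A\<close>, so \<open>Z <#> A\<close> avoids the
  inverses of \<open>F\<close>. The first and third claims together show that the excess of
  \<open>Z\<close> is at most that of \<open>F\<close>.\<close>

lemma (in comm_group) card_carrier_diff_set_mult:
  assumes "finite (carrier G)" "F \<subseteq> carrier G" "A \<subseteq> carrier G" "F \<noteq> {}"
  defines "Z \<equiv> m_inv G ` (carrier G - (F <#> A))"
  shows "card Z = card (carrier G) - card (F <#> A)"
    and "Z <#> A \<noteq> carrier G"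
    and "card (Z <#> A) \<le> card (carrier G) - card F"
proof -
  have FA: "F <#> A \<subseteq> carrier G"
    using assms by (rule_tac set_mult_closed)
  have "inj_on (m_inv G) (carrier G - (F <#> A))"
    by (metis DiffD1 inj_onI inv_inv)
  then show "card Z = card (carrier G) - card (F <#> A)"
    using assms FA by (simp add: card_image card_Diff_subset finite_subset)
  have *: "Z <#> A \<subseteq> carrier G - m_inv G ` F"
  proof
    fix z assume "z \<in> Z <#> A"
    then obtain y a where ya: "y \<in> carrier G" "y \<notin> F <#> A" "a \<in> A" "z = inv y \<otimes> a"
      by (auto simp: Z_def mem_set_mult_iff)
    have a: "a \<in> carrier G"
      using assms ya by auto
    have "z \<noteq> inv f" if "f \<in> F" for f
    proof
      assume "z = inv f"
      have f: "f \<in> carrier G"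
        using assms that by auto
      have "inv y \<otimes> a = inv f"
        using ya \<open>z = inv f\<close> by simp
      then have "f \<otimes> a = y"
        using ya a f by (metis inv_closed inv_inv m_comm inv_solve_left')
      then show False
        using ya that by (auto simp: mem_set_mult_iff)
    qed
    then show "z \<in> carrier G - m_inv G ` F"
      using ya a by auto
  qed
  have "inv f \<in> carrier G" if "f \<in> F" for f
    using assms that by auto
  with * assms show "Z <#> A \<noteq> carrier G"
    by blast
  have "inj_on (m_inv G) F"
    using assms(2) by (intro inj_onI) (metis inv_inv subsetD)
  then have "card (carrier G - m_inv G ` F) = card (carrier G) - card F"
    using assms by (subst card_Diff_subset) (auto simp: card_image finite_subset)
  then show "card (Z <#> A) \<le> card (carrier G) - card F"
    using card_mono[OF _ *] assms by auto
qed

section \<open>Atoms and Olson's growth estimate\<close>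

text \<open>An \<open>F\<close> that satisfies the assumptions below is an atom in the sense of Hamidoune.\<close>

lemma (in comm_group) atom_translates:
  assumes fin: "finite (carrier G)" and A: "A \<subseteq> carrier G" "\<one> \<in> A"
    and F: "F \<subseteq> carrier G" "F \<noteq> {}" "F <#> A \<noteq> carrier G"
    and F_min: "\<And>X. X \<subseteq> carrier G \<Longrightarrow> X \<noteq> {} \<Longrightarrow> X <#> A \<noteq> carrier G \<Longrightarrow>
      card (F <#> A) - card F \<le> card (X <#> A) - card X"
    and F_small: "\<And>X. X \<subseteq> carrier G \<Longrightarrow> X \<noteq> {} \<Longrightarrow> X <#> A \<noteq> carrier G \<Longrightarrow>
      card (X <#> A) - card X = card (F <#> A) - card F \<Longrightarrow> card F \<le> card X"
    and g: "g \<in> carrier G" and meet: "F \<inter> (F #> g) \<noteq> {}"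
  shows "F #> g = F"
proof (rule ccontr)
  assume neq: "F #> g \<noteq> F"
  let ?E = "F #> g"
  let ?d = "\<lambda>X. card (X <#> A) - card X"
  have closed: "X <#> A \<subseteq> carrier G" if "X \<subseteq> carrier G" for X
    using that A by (rule_tac set_mult_closed)
  have finite: "finite X" if "X \<subseteq> carrier G" for X
    using that fin finite_subset by blast
  have grow: "card X \<le> card (X <#> A)" if "X \<subseteq> carrier G" for X
    using that A closed finite by (intro card_mono subset_set_mult) auto
  have E: "?E \<subseteq> carrier G"
    using F g r_coset_subset_G by blast
  have cardE: "card ?E = card F"
    using F g by (rule_tac card_r_coset)
  have cardEA: "card (?E <#> A) = card (F <#> A)"
    using F A g closed by (simp add: r_coset_set_mult card_r_coset)
  have I: "F \<inter> ?E \<subseteq> carrier G" "F \<union> ?E \<subseteq> carrier G"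
    using F E by auto
  have "F \<inter> ?E \<noteq> F"
  proof
    assume "F \<inter> ?E = F"
    then have "F \<subseteq> ?E" by blast
    then show False
      using card_subset_eq[OF finite[OF E], of F] cardE neq by simp
  qed
  then have "card (F \<inter> ?E) < card F"
    using finite F by (intro psubset_card_mono) auto
  moreover have IA: "(F \<inter> ?E) <#> A \<noteq> carrier G"
    using F closed[OF F(1)] mono_set_mult[of "F \<inter> ?E" F A A G] by auto
  \<comment> \<open>A set smaller than \<open>F\<close> cannot be a minimiser, so the proper subset
    \<open>F \<inter> ?E\<close> has strictly larger excess.\<close>
  ultimately have less: "?d F < ?d (F \<inter> ?E)"
    using F_min[OF I(1) meet IA] F_small[OF I(1) meet IA] by linarith
  \<comment> \<open>By duality \<open>Z\<close> is again a minimiser, so \<open>card F \<le> card Z\<close>; hence \<open>F \<union> F #> g\<close> is too small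
    for its product with \<open>A\<close> to be the whole group.\<close>
  define Z where "Z = m_inv G ` (carrier G - (F <#> A))"
  have Z: "card Z = card (carrier G) - card (F <#> A)" "Z <#> A \<noteq> carrier G"
    "card (Z <#> A) \<le> card (carrier G) - card F" "Z \<subseteq> carrier G" "Z \<noteq> {}"
    using card_carrier_diff_set_mult[OF fin F(1) A(1) F(2)] closed[OF F(1)] F(3)
    unfolding Z_def by auto
  have le: "card F \<le> card (F <#> A)" "card (F <#> A) \<le> card (carrier G)"
    using grow[OF F(1)] closed[OF F(1)] fin by (auto intro: card_mono)
  have FZ: "card F \<le> card Z"
  proof (rule F_small[OF Z(4,5,2)])
    show "?d Z = ?d F"
      using F_min[OF Z(4,5,2)] Z(1,3) le by linarith
  qed
  have un: "card (F \<union> ?E) + card (F \<inter> ?E) = 2 * card F"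
    using card_Un_Int[of F ?E] finite F E cardE by simp
  have sub: "card ((F \<inter> ?E) <#> A) + card ((F \<union> ?E) <#> A) \<le> 2 * card (F <#> A)"
    using card_set_mult_submodular[of F ?E A G] finite F E A cardEA by simp
  \<comment> \<open>By submodularity the two excesses sum to at most \<open>2 * ?d F\<close>; as the
    intersection lies above the minimum, the union falls below it and cannot be an admissible
    set.\<close>
  have small_d: "?d (F \<union> ?E) < ?d F"
    using less sub un grow[OF I(1)] grow[OF I(2)] le by linarith
  then have "(F \<union> ?E) <#> A = carrier G"
    using F_min[OF I(2)] F(2) by fastforce
  then have "card (carrier G) < card (F <#> A) - card F + card (F \<union> ?E)"
    using small_d grow[OF I(2)] by simp
  moreover have "0 < card (F \<inter> ?E)"
    using meet finite[OF I(1)] by (simp add: card_gt_0_iff)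
  ultimately show False
    using un FZ Z(1) le by linarith
qed

text \<open>It suffices to bound the excess of an atom \<open>F\<close>, and translation preserves
  the excess. A translate of \<open>F\<close> that meets \<open>F\<close> equals \<open>F\<close>,
  which makes the translate \<open>H\<close> through \<open>\<one>\<close> a subgroup. Since
  \<open>H <#> A\<close> contains \<open>A\<close> and two cosets of \<open>H\<close>, the excess of
  \<open>H\<close> is at least half of \<open>card (H <#> A)\<close>, hence of
  \<open>card A\<close>.\<close>

theorem (in comm_group) Olson:
  assumes fin: "finite (carrier G)" and A: "A \<subseteq> carrier G" "\<one> \<in> A" "generate G A = carrier G"
    and X: "X \<subseteq> carrier G" "X \<noteq> {}" "X <#> A \<noteq> carrier G"
  shows "2 * card X + card A \<le> 2 * card (X <#> A)"
proof -
  define d where "d X = card (X <#> A) - card X" for X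
  define P where "P X \<longleftrightarrow> X \<subseteq> carrier G \<and> X \<noteq> {} \<and> X <#> A \<noteq> carrier G" for X
  have closed: "X <#> A \<subseteq> carrier G" if "X \<subseteq> carrier G" for X
    using that A by (rule_tac set_mult_closed)
  have grow: "card X \<le> card (X <#> A)" if "X \<subseteq> carrier G" for X
    using that A closed fin by (meson card_mono finite_subset subset_set_mult)
  have "P X"
    using X by (simp add: P_def)
  then obtain Y where Y: "P Y" "\<And>X. P X \<Longrightarrow> d Y \<le> d X"
    using ex_has_least_nat[of P X d] by blast
  \<comment> \<open>A second minimisation, now of the size among all minimisers of \<open>d\<close>,
    makes \<open>F\<close> an atom.\<close>
  have "\<exists>F. (P F \<and> d F = d Y) \<and> (\<forall>X. P X \<and> d X = d Y \<longrightarrow> card F \<le> card X)"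
    by (rule ex_has_least_nat[of _ Y]) (use Y(1) in simp)
  then obtain F where "P F" and dF: "d F = d Y"
    and F_small: "\<And>X. P X \<Longrightarrow> d X = d Y \<Longrightarrow> card F \<le> card X"
    by blast
  then have F: "F \<subseteq> carrier G" "F \<noteq> {}" "F <#> A \<noteq> carrier G"
    by (simp_all add: P_def)
  have translate: "F #> g = F" if "g \<in> carrier G" "F \<inter> (F #> g) \<noteq> {}" for g
    using fin A(1,2) F _ _ that
  proof (rule atom_translates)
    fix X assume "X \<subseteq> carrier G" "X \<noteq> {}" "X <#> A \<noteq> carrier G"
    then have "P X"
      by (simp add: P_def)
    show "card (F <#> A) - card F \<le> card (X <#> A) - card X"
      using Y(2)[OF \<open>P X\<close>] dF by (simp add: d_def)
    show "card F \<le> card X" if "card (X <#> A) - card X = card (F <#> A) - card F"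
      using F_small[OF \<open>P X\<close>] dF that by (simp add: d_def)
  qed
  obtain f where f: "f \<in> F" "f \<in> carrier G"
    using F by blast
  define H where "H = F #> inv f"
  have H: "H \<subseteq> carrier G"
    using F f r_coset_subset_G H_def by auto
  have "\<one> \<in> H"
    using f by (auto simp: H_def r_coset_def intro!: bexI[of _ f])
  have diff: "x \<otimes> inv y \<in> H" if "x \<in> H" "y \<in> H" for x y
  proof -
    from that obtain u v where uv: "u \<in> F" "v \<in> F" "x = u \<otimes> inv f" "y = v \<otimes> inv f"
      by (auto simp: H_def r_coset_def)
    then have c: "u \<in> carrier G" "v \<in> carrier G"
      using F by auto
    \<comment> \<open>As \<open>f = v \<otimes> (inv v \<otimes> f)\<close>, this translate meets
      \<open>F\<close> in \<open>f\<close> and so coincides with \<open>F\<close>.\<close>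
    have "f \<in> F #> (inv v \<otimes> f)"
      using uv c f by (auto simp: r_coset_def m_assoc[symmetric] intro!: bexI[of _ v])
    then have "F #> (inv v \<otimes> f) = F"
      using c f by (intro translate) auto
    then have "u \<otimes> (inv v \<otimes> f) \<in> F"
      using uv by (auto simp: r_coset_def)
    moreover have "x \<otimes> inv y = (u \<otimes> (inv v \<otimes> f)) \<otimes> inv f"
      using uv c f by (simp add: inv_mult m_ac)
    ultimately show ?thesis
      by (auto simp: H_def r_coset_def)
  qed
  have "subgroup H G"
  proof (rule subgroupI)
    show inv: "inv a \<in> H" if "a \<in> H" for a
      using diff[OF \<open>\<one> \<in> H\<close> that] that H by auto
    show "a \<otimes> b \<in> H" if "a \<in> H" "b \<in> H" for a b
      using diff[OF that(1) inv[OF that(2)]] that H by auto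
  qed (use H \<open>\<one> \<in> H\<close> in auto)
  have HA: "H <#> A = (F <#> A) #> inv f"
    using F f A by (simp add: H_def r_coset_set_mult)
  then have cHA: "card (H <#> A) = card (F <#> A)"
    using F f closed by (simp add: card_r_coset)
  have cH: "card H = card F"
    using F f by (simp add: H_def card_r_coset)
  have "card (H <#> A) \<noteq> card (carrier G)"
    using F closed fin by (metis cHA card_subset_eq)
  then have "H \<noteq> carrier G"
    using closed[OF H] grow[OF H] fin by (metis antisym card_mono)
  then have "\<not> A \<subseteq> H"
    using generate_subgroup_incl[OF _ \<open>subgroup H G\<close>, of A] A(3) H by auto
  then obtain a where a: "a \<in> A" "a \<notin> H" "a \<in> carrier G"
    using A by blast
  have "H \<inter> (H #> a) = {}"
  proof -
    have False if "h \<in> H" "h \<otimes> a \<in> H" for h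
      using that a H subgroup.m_closed[OF \<open>subgroup H G\<close>] subgroup.m_inv_closed[OF \<open>subgroup H G\<close>]
      by (metis inv_solve_left subsetD)
    then show ?thesis
      by (auto simp: r_coset_def)
  qed
  moreover have "H \<union> (H #> a) \<subseteq> H <#> A"
    using subset_set_mult[OF H A(2)] a by (auto simp: r_coset_def set_mult_def)
  ultimately have "2 * card H \<le> card (H <#> A)"
    using card_Un_disjoint[of H "H #> a"] card_r_coset[OF H a(3)] closed[OF H] H fin
      card_mono[of "H <#> A" "H \<union> (H #> a)"]
    by (metis finite_subset mult_2 le_sup_iff)
  moreover have "card A \<le> card (H <#> A)"
  proof (rule card_mono)
    show "finite (H <#> A)"
      using closed[OF H] fin finite_subset by blast
    show "A \<subseteq> H <#> A"
    proof
      fix x assume "x \<in> A"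
      moreover from this have "x = \<one> \<otimes> x"
        using A(1) by auto
      ultimately show "x \<in> H <#> A"
        using \<open>\<one> \<in> H\<close> unfolding mem_set_mult_iff by blast
    qed
  qed
  moreover have "card (F <#> A) - card F \<le> card (X <#> A) - card X"
    using Y(2)[OF \<open>P X\<close>] dF by (simp add: d_def)
  ultimately show ?thesis
    using cH cHA grow[OF X(1)] by linarith
qed

section \<open>Iterated product sets\<close>

definition (in monoid) set_power :: "'a set \<Rightarrow> nat \<Rightarrow> 'a set" where
  "set_power A h = ((\<lambda>X. X <#> A) ^^ h) {\<one>}"

lemma (in monoid) set_power_0 [simp]: "set_power A 0 = {\<one>}"
  by (simp add: set_power_def)

lemma (in monoid) set_power_Suc [simp]: "set_power A (Suc h) = set_power A h <#> A"
  by (simp add: set_power_def)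

lemma (in monoid) set_power_closed: "A \<subseteq> carrier G \<Longrightarrow> set_power A h \<subseteq> carrier G"
  by (induction h) (auto simp: set_mult_closed)

text \<open>By Olson's estimate each further factor adds at least half of \<open>card A\<close>. The
  first factor yields \<open>A\<close> itself and so counts twice, whence \<open>h + 2\<close>
  rather than \<open>h + 1\<close>.\<close>

lemma (in comm_group) card_set_power:
  assumes "finite (carrier G)" "A \<subseteq> carrier G" "\<one> \<in> A" "generate G A = carrier G"
    and "set_power A (Suc h) \<noteq> carrier G"
  shows "(h + 2) * card A \<le> 2 * card (set_power A (Suc h))"
  using assms(5)
proof (induction h)
  case 0
  have "{\<one>} <#> A = A"
    using assms(2) by (force simp: set_mult_def)
  then show ?case
    by simp
next
  case (Suc h)
  let ?X = "set_power A (Suc h)"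
  have X: "?X \<subseteq> carrier G"
    using assms(2) by (rule set_power_closed)
  have XA: "?X <#> A \<noteq> carrier G"
    using Suc.prems by simp
  then have "?X \<noteq> carrier G"
    using subset_set_mult[OF X assms(3)] set_mult_closed[OF X assms(2)] by auto
  then have IH: "(h + 2) * card A \<le> 2 * card ?X"
    by (rule Suc.IH)
  have "card A > 0"
    using assms(1-3) by (metis card_gt_0_iff empty_iff finite_subset)
  with IH have "?X \<noteq> {}"
    by auto
  from Olson[OF assms(1-4) X this XA] IH show ?case
    by simp
qed

lemma (in comm_group) set_power_eq_carrier:
  assumes "finite (carrier G)" "A \<subseteq> carrier G" "\<one> \<in> A" "generate G A = carrier G"
  shows "set_power A (2 * (card (carrier G) div card A)) = carrier G"
proof -
  define q where "q = card (carrier G) div card A"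
  have "card A > 0" "card A \<le> card (carrier G)"
    using assms(1-3) by (auto simp: card_gt_0_iff card_mono intro: finite_subset)
  then have "q > 0"
    by (simp add: q_def div_greater_zero_iff)
  then obtain h where h: "2 * q = Suc (Suc h)"
    by (metis Suc_pred mult_2 add_gr_0 add_Suc)
  let ?X = "set_power A (Suc h)"
  have X: "?X \<subseteq> carrier G"
    using assms(2) by (rule set_power_closed)
  have "?X <#> A = carrier G"
  proof (cases "?X = carrier G")
    case True
    then show ?thesis
      using subset_set_mult[OF X assms(3)] set_mult_closed[OF X assms(2)] by auto
  next
    case False
    have "2 * q * card A \<le> 2 * card ?X"
      using card_set_power[OF assms False] h by simp
    \<comment> \<open>The remainder of the division is less than \<open>card A\<close>, so the
      \<open>q * card A\<close> elements of \<open>?X\<close> suffice for the pigeonhole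
      principle.\<close>
    moreover have "card (carrier G) < q * card A + card A"
      unfolding q_def using \<open>card A > 0\<close> by (metis dividend_less_div_times add.commute)
    ultimately show ?thesis
      using assms X by (intro set_mult_eq_carrier_of_card) auto
  qed
  then show ?thesis
    using h by (simp flip: q_def)
qed

section \<open>Residues of the generators\<close>

lemma mult_mem_of_diff_closed:
  fixes H :: "int set"
  assumes H: "0 \<in> H" "\<And>x y. x \<in> H \<Longrightarrow> y \<in> H \<Longrightarrow> x - y \<in> H" and "x \<in> H"
  shows "c * x \<in> H"
proof -
  \<comment> \<open>Negative multiples come first because closure under differences yields them
    directly from \<open>0\<close>.\<close>
  have nat_mult: "- (int n * x) \<in> H" for n
  proof (induction n)
    case (Suc n)
    then have "- (int n * x) - x \<in> H"
      using \<open>x \<in> H\<close> by (rule H(2))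
    moreover have "- (int n * x) - x = - (int (Suc n) * x)"
      by (simp add: algebra_simps)
    ultimately show ?case
      by simp
  qed (use H in simp)
  show ?thesis
  proof (cases c rule: int_cases2)
    case (nonneg n)
    then show ?thesis
      using H(2)[OF H(1) nat_mult[of n]] by simp
  next
    case (nonpos n)
    then show ?thesis
      using nat_mult[of n] by simp
  qed
qed

text \<open>The hypotheses make \<open>H\<close> an additive subgroup of the integers, so Bezout's
  identity applies to one element of \<open>S\<close> at a time.\<close>

lemma Gcd_mem_of_diff_closed:
  fixes H :: "int set"
  assumes "0 \<in> H" "\<And>x y. x \<in> H \<Longrightarrow> y \<in> H \<Longrightarrow> x - y \<in> H" "finite S" "S \<subseteq> H"
  shows "Gcd S \<in> H"
  using assms(3,4)
proof (induction S rule: finite_induct)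
  case empty
  then show ?case
    using assms(1) by simp
next
  case (insert a S)
  obtain u v where "u * a + v * Gcd S = gcd a (Gcd S)"
    using bezout_int by blast
  moreover have "u * a + v * Gcd S \<in> H"
    using insert assms(2)[OF mult_mem_of_diff_closed[OF assms(1,2), of a u]
      mult_mem_of_diff_closed[OF assms(1,2), of "Gcd S" "- v"]] by simp
  ultimately show ?case
    by simp
qed

text \<open>The preimage in the integers of the generated subgroup is closed under differences and
  contains \<open>S\<close>; hence it contains \<open>Gcd S = 1\<close>, and so every
  integer.\<close>

lemma generate_integer_mod_group:
  fixes S :: "int set"
  assumes "finite S" "Gcd S = 1" "m > 0"
  shows "generate (integer_mod_group m) ((\<lambda>z. z mod int m) ` S) = carrier (integer_mod_group m)"
    (is "?gen = _")
proof
  interpret group "integer_mod_group m"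
    by simp
  have car: "carrier (integer_mod_group m) = {0..<int m}"
    using assms(3) by (simp add: carrier_integer_mod_group)
  let ?A = "(\<lambda>z. z mod int m) ` S"
  have A: "?A \<subseteq> carrier (integer_mod_group m)"
    unfolding car using assms(3) by auto
  then show "?gen \<subseteq> carrier (integer_mod_group m)"
    by (rule generate_incl)
  have sub: "subgroup ?gen (integer_mod_group m)"
    using A by (rule generate_is_subgroup)
  define H where "H = {z. z mod int m \<in> ?gen}"
  have H0: "0 \<in> H"
    using subgroup.one_closed[OF sub] by (simp add: H_def)
  have Hdiff: "x - y \<in> H" if "x \<in> H" "y \<in> H" for x y
  proof -
    have "inv\<^bsub>integer_mod_group m\<^esub> (y mod int m) = (- (y mod int m)) mod int m"
      using assms(3) car by (intro inv_integer_mod_group) auto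
    then have "(x mod int m + (- (y mod int m)) mod int m) mod int m \<in> ?gen"
      using subgroup.m_closed[OF sub, of "x mod int m" "inv\<^bsub>integer_mod_group m\<^esub> (y mod int m)"]
        subgroup.m_inv_closed[OF sub, of "y mod int m"] that by (simp add: H_def)
    moreover have "(x mod int m + (- (y mod int m)) mod int m) mod int m = (x - y) mod int m"
      by (simp add: mod_simps)
    ultimately show ?thesis
      by (simp add: H_def)
  qed
  have "S \<subseteq> H"
    by (auto simp: H_def intro: generate.incl)
  have "1 \<in> H"
    using Gcd_mem_of_diff_closed[OF H0 Hdiff assms(1) \<open>S \<subseteq> H\<close>] assms(2) by simp
  have "z \<in> H" for z :: int
    using mult_mem_of_diff_closed[OF H0 Hdiff \<open>1 \<in> H\<close>, of z] by simp
  then have "z mod int m \<in> ?gen" for z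
    by (simp add: H_def)
  then show "carrier (integer_mod_group m) \<subseteq> ?gen"
    unfolding car by (metis atLeastLessThan_iff mod_pos_pos_trivial subsetI)
qed

text \<open>Collecting the \<open>h\<close> summands by index turns an element of the sumset into
  multiplicities \<open>x\<close>; one more summand with index \<open>j\<close> raises
  \<open>x j\<close> by one.\<close>

lemma set_power_residuesE:
  fixes \<alpha> :: "nat \<Rightarrow> int"
  assumes "m > 0" "finite I"
    and "z \<in> monoid.set_power (integer_mod_group m) ((\<lambda>i. \<alpha> i mod int m) ` I) h"
  obtains x :: "nat \<Rightarrow> nat" where "(\<Sum>i\<in>I. x i) = h" "(\<Sum>i\<in>I. int (x i) * \<alpha> i) mod int m = z"
proof -
  interpret group "integer_mod_group m"
    by simp
  have "\<exists>x. (\<Sum>i\<in>I. x i) = h \<and> (\<Sum>i\<in>I. int (x i) * \<alpha> i) mod int m = z"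
    using assms(3)
  proof (induction h arbitrary: z)
    case 0
    then show ?case
      by (auto intro!: exI[of _ "\<lambda>_. 0"])
  next
    case (Suc h)
    then obtain w j where w: "w \<in> set_power ((\<lambda>i. \<alpha> i mod int m) ` I) h" and j: "j \<in> I"
      and z: "z = (w + \<alpha> j mod int m) mod int m"
      by (auto simp: mem_set_mult_iff)
    from Suc.IH[OF w] obtain x where x: "(\<Sum>i\<in>I. x i) = h"
      "(\<Sum>i\<in>I. int (x i) * \<alpha> i) mod int m = w"
      by blast
    have "(\<Sum>i\<in>I. (x(j := Suc (x j))) i) = Suc h"
      using x(1) assms(2) j by (simp add: sum.remove[of I j])
    moreover have "(\<Sum>i\<in>I. int ((x(j := Suc (x j))) i) * \<alpha> i) = (\<Sum>i\<in>I. int (x i) * \<alpha> i) + \<alpha> j"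
      using assms(2) j by (simp add: sum.remove[of I j] algebra_simps)
    moreover have "((\<Sum>i\<in>I. int (x i) * \<alpha> i) + \<alpha> j) mod int m = z"
      using z by (simp add: mod_simps flip: x(2))
    ultimately show ?case
      by (intro exI[of _ "x(j := Suc (x j))"]) simp
  qed
  then show ?thesis
    using that by blast
qed

section \<open>The bound for the Frobenius number\<close>

theorem lemma2p1:
  fixes k :: nat and \<alpha> :: "nat \<Rightarrow> int"
  assumes "k \<ge> 2"
    and "0 < \<alpha> 1"
    and "strict_mono_on {1..k} \<alpha>"
    and "Gcd (\<alpha> ` {1..k}) = 1"
    and "\<And>i j. i \<in> {1..k} \<Longrightarrow> j \<in> {1..k} \<Longrightarrow> i \<noteq> j \<Longrightarrow> \<not> [\<alpha> i = \<alpha> j] (mod \<alpha> 1)"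
  shows "frobenius_number k \<alpha> \<le> 2 * \<alpha> k * (\<alpha> 1 div int k) - \<alpha> 1"
proof -
  define m where "m = nat (\<alpha> 1)"
  have m: "m > 0" "int m = \<alpha> 1"
    using assms(2) by (auto simp: m_def)
  interpret comm_group "integer_mod_group m"
    by simp
  have car: "carrier (integer_mod_group m) = {0..<int m}"
    using m by (simp add: carrier_integer_mod_group)
  define A where "A = (\<lambda>i. \<alpha> i mod int m) ` {1..k}"
  have A: "A \<subseteq> carrier (integer_mod_group m)"
    using m(1) by (auto simp: A_def car)
  have "0 \<in> A"
    using assms(1) m(2) by (auto simp: A_def image_iff intro!: bexI[of _ 1])
  have "inj_on (\<lambda>i. \<alpha> i mod int m) {1..k}"
    using assms(5) m(2) unfolding inj_on_def cong_def by metis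
  then have "card A = k"
    by (simp add: A_def card_image)
  have gen: "generate (integer_mod_group m) A = carrier (integer_mod_group m)"
    using generate_integer_mod_group[OF _ assms(4) m(1)] by (simp add: A_def image_image)
  define q where "q = m div k"
  have q: "int q = \<alpha> 1 div int k"
    unfolding q_def m(2)[symmetric] by (rule zdiv_int)
  have full: "set_power A (2 * q) = {0..<int m}"
    using set_power_eq_carrier[of A] A \<open>0 \<in> A\<close> gen by (simp add: car \<open>card A = k\<close> q_def)
  have pos: "0 < \<alpha> i" and le_last: "\<alpha> i \<le> \<alpha> k" if "i \<in> {1..k}" for i
    using that assms(1,2) strict_mono_on_leD[OF assms(3), of 1 i]
      strict_mono_on_leD[OF assms(3), of i k] by auto
  define B where "B = 2 * \<alpha> k * (\<alpha> 1 div int k) - \<alpha> 1"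
  have mem: "n \<in> numerical_semigroup k \<alpha>" if "n > B" for n
  proof -
    have "n mod int m \<in> set_power A (2 * q)"
      using m(1) by (simp add: full)
    then obtain x where x: "(\<Sum>i=1..k. x i) = 2 * q"
      "(\<Sum>i=1..k. int (x i) * \<alpha> i) mod int m = n mod int m"
      using set_power_residuesE[OF m(1), of "{1..k}" "n mod int m" \<alpha> "2 * q"]
      unfolding A_def by auto
    let ?s = "\<Sum>i=1..k. int (x i) * \<alpha> i"
    \<comment> \<open>The residue is represented by exactly \<open>2 * q\<close> generators, each at
      most \<open>\<alpha> k\<close>.\<close>
    have "?s \<le> (\<Sum>i=1..k. int (x i) * \<alpha> k)"
      by (intro sum_mono mult_left_mono le_last) auto
    also have "\<dots> = int (\<Sum>i=1..k. x i) * \<alpha> k"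
      by (simp add: sum_distrib_right)
    also have "\<dots> = 2 * \<alpha> k * (\<alpha> 1 div int k)"
      unfolding x(1) q[symmetric] by simp
    finally have "?s < n + int m"
      using that m(2) by (simp add: B_def)
    moreover obtain c where c: "n - ?s = int m * c"
      using x(2) by (metis mod_eq_dvd_iff dvdE)
    \<comment> \<open>\<open>n - ?s\<close> is a multiple of \<open>m\<close> greater than
      \<open>- m\<close>, so it is nonnegative.\<close>
    ultimately have "int m * (- 1) < int m * c"
      by simp
    then have "c \<ge> 0"
      using m(1) by (simp only: mult_less_cancel_left_pos)
    have 1: "1 \<in> {1..k}"
      using assms(1) by auto
    have "n = ?s + \<alpha> 1 * c"
      using c m(2) by simp
    \<comment> \<open>The surplus is absorbed as \<open>c\<close> further copies of the generator
      \<open>\<alpha> 1\<close>.\<close>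
    also have "\<dots> = (\<Sum>i=1..k. int ((x(1 := x 1 + nat c)) i) * \<alpha> i)"
      using \<open>c \<ge> 0\<close> unfolding sum.remove[OF finite_atLeastAtMost 1] by (simp add: algebra_simps)
    finally show ?thesis
      unfolding numerical_semigroup_def by blast
  qed
  have nonneg: "n \<ge> 0" if "n \<in> numerical_semigroup k \<alpha>" for n
    using that pos
    by (fastforce simp: numerical_semigroup_def intro!: sum_nonneg mult_nonneg_nonneg intro: less_imp_le)
  \<comment> \<open>\<open>GREATEST\<close> has to be shown to be attained. The candidates start at
    \<open>-1\<close>, which is always missing because the generators are positive; this makes
    \<open>N\<close> nonempty, and \<open>mem\<close> bounds the missing integers by
    \<open>B\<close>.\<close>
  define N where "N = {-1..B} - numerical_semigroup k \<alpha>"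
  have minus1: "-1 \<notin> numerical_semigroup k \<alpha>"
    using nonneg by fastforce
  then have N: "finite N" "-1 \<in> N"
    using mem[of "-1"] by (auto simp: N_def intro: leI)
  then have max: "Max N \<in> N"
    by (intro Max_in) auto
  have "frobenius_number k \<alpha> = Max N"
    unfolding frobenius_number_def
  proof (rule Greatest_equality)
    show "Max N \<notin> numerical_semigroup k \<alpha>"
      using max by (simp add: N_def)
    fix y assume y: "y \<notin> numerical_semigroup k \<alpha>"
    show "y \<le> Max N"
    proof (cases "y \<ge> -1")
      case True
      then have "y \<in> N"
        using y mem[of y] by (auto simp: N_def intro: leI)
      then show ?thesis
        using N by simp
    next
      case False
      then show ?thesis
        using Max_ge[OF N] by linarith
    qed
  qed
  also have "Max N \<le> B"
    using max unfolding N_def by simp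
  finally show ?thesis
    by (simp add: B_def)
qed

end
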